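(* Let $n \geq 1$ be a positive integer, let $R_n$ be the dihedral quandle of order $n$, and let $\varphi$ denote Euler's totient function. Let $v(R_n)$ be the number of isomorphism classes of virtual quandles whose underlying quandles are isomorphic to $R_n$. Then $$v(R_n)=\varphi(n)\sum_{d\mid n}\frac{1}{\varphi(d)},$$ where the sum runs over the positive divisors $d$ of $n$.
   Context: Composition of maps is written $\psi\chi$ (first $\chi$, then $\psi$). For a set $X$, $S_X$ denotes the symmetric group of $X$ (all bijections $X\to X$). A rack is a pair $R=(X,s)$ where $X$ is a set and $s:X\to S_X$, $x\mapsto s_x$, is a map such that $s_xs_y=s_{s_x(y)}s_x$ for all $x,y\in X$. It is a quandle if in addition $s_x(x)=x$ for all $x\in X$. The dihedral quandle $R_n$ of order $n$ is the quandle $(\mathbb{Z}/n\mathbb{Z},s)$ with $s_g(h)=2g-h$ for all $g,h\in\mathbb{Z}/n\mathbb{Z}$. A rack homomorphism from $(X,s)$ to $(Y,t)$ is a map $\psi:X\to Y$ with $\psi s_x=t_{\psi(x)}\psi$ for all $x\in X$. A rack isomorphism is a bijective rack homomorphism; an automorphism of a rack $R$ is an isomorphism from $R$ to itself; and $\operatorname{Aut} R$ is the group of automorphisms of $R$ under composition. A virtual rack is a pair $(R,f)$ where $R$ is a rack and $f\in\operatorname{Aut}R$; it is a virtual quandle if $R$ is a quandle. $R$ is called the underlying rack (resp. quandle) of $(R,f)$. A virtual rack homomorphism from $(R_1,f_1)$ to $(R_2,f_2)$ is a rack homomorphism $\psi$ from $R_1$ to $R_2$ with $\psi f_1=f_2\psi$;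 a virtual rack isomorphism is a bijective virtual rack homomorphism. Virtual quandles are considered up to virtual rack isomorphism. *)

theory Defs
  imports "HOL-Algebra.Bij" "HOL-Number_Theory.Totient"
begin

text \<open>
  The symmetric group of a set \<open>X\<close> is \<open>Bij X\<close>, whose elements are extensional, i.e. undefined
  outside \<open>X\<close>. Together with the extensionality of \<open>act\<close> in its first argument this makes every
  map \<open>X \<Rightarrow> S\<^sub>X\<close> be represented exactly once.
\<close>

record 'a rack = "'a partial_object" +
  act :: "'a \<Rightarrow> 'a \<Rightarrow> 'a"

definition is_rack :: "'a rack \<Rightarrow> bool" where
  "is_rack R \<longleftrightarrow>
     act R \<in> carrier R \<rightarrow>\<^sub>E Bij (carrier R) \<and>
     (\<forall>x\<in>carrier R. \<forall>y\<in>carrier R.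
        compose (carrier R) (act R x) (act R y) =
        compose (carrier R) (act R (act R x y)) (act R x))"

definition is_quandle :: "'a rack \<Rightarrow> bool" where
  "is_quandle R \<longleftrightarrow> is_rack R \<and> (\<forall>x\<in>carrier R. act R x x = x)"

definition dihedral_quandle :: "nat \<Rightarrow> int rack" where
  "dihedral_quandle n =
     \<lparr> carrier = {0..<int n},
       act = (\<lambda>g\<in>{0..<int n}. \<lambda>h\<in>{0..<int n}. (2 * g - h) mod int n) \<rparr>"

definition rack_hom :: "'a rack \<Rightarrow> 'b rack \<Rightarrow> ('a \<Rightarrow> 'b) set" where
  "rack_hom R S =
     {\<psi> \<in> carrier R \<rightarrow> carrier S.
        \<forall>x\<in>carrier R. \<forall>y\<in>carrier R. \<psi> (act R x y) = act S (\<psi> x) (\<psi> y)}"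

definition rack_iso :: "'a rack \<Rightarrow> 'b rack \<Rightarrow> ('a \<Rightarrow> 'b) set" where
  "rack_iso R S = {\<psi> \<in> rack_hom R S. bij_betw \<psi> (carrier R) (carrier S)}"

definition rack_isomorphic :: "'a rack \<Rightarrow> 'b rack \<Rightarrow> bool" where
  "rack_isomorphic R S \<longleftrightarrow> rack_iso R S \<noteq> {}"

definition rack_auto :: "'a rack \<Rightarrow> ('a \<Rightarrow> 'a) set" where
  "rack_auto R = rack_iso R R \<inter> Bij (carrier R)"

type_synonym 'a virtual_rack = "'a rack \<times> ('a \<Rightarrow> 'a)"

definition is_virtual_rack :: "'a virtual_rack \<Rightarrow> bool" where
  "is_virtual_rack V \<longleftrightarrow> is_rack (fst V) \<and> snd V \<in> rack_auto (fst V)"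

definition is_virtual_quandle :: "'a virtual_rack \<Rightarrow> bool" where
  "is_virtual_quandle V \<longleftrightarrow> is_virtual_rack V \<and> is_quandle (fst V)"

definition virtual_rack_hom :: "'a virtual_rack \<Rightarrow> 'b virtual_rack \<Rightarrow> ('a \<Rightarrow> 'b) set" where
  "virtual_rack_hom V W =
     {\<psi> \<in> rack_hom (fst V) (fst W). \<forall>x\<in>carrier (fst V). \<psi> (snd V x) = snd W (\<psi> x)}"

definition virtual_rack_iso :: "'a virtual_rack \<Rightarrow> 'b virtual_rack \<Rightarrow> ('a \<Rightarrow> 'b) set" where
  "virtual_rack_iso V W =
     {\<psi> \<in> virtual_rack_hom V W. bij_betw \<psi> (carrier (fst V)) (carrier (fst W))}"

definition virtual_rack_isomorphic :: "'a virtual_rack \<Rightarrow> 'b virtual_rack \<Rightarrow> bool" where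
  "virtual_rack_isomorphic V W \<longleftrightarrow> virtual_rack_iso V W \<noteq> {}"

text \<open>
  The underlying sets are drawn from the type \<open>'a\<close>, which may differ from the type \<open>'b\<close> carrying
  the given quandle. If \<open>'a\<close> is infinite, every finite virtual quandle is isomorphic to one
  over \<open>'a\<close>, so no isomorphism class of finite virtual quandles is missed.
\<close>

definition virtual_quandles_over :: "'b rack \<Rightarrow> 'a virtual_rack set" where
  "virtual_quandles_over Q = {V. is_virtual_quandle V \<and> rack_isomorphic (fst V) Q}"

definition virtual_quandle_classes :: "'b rack \<Rightarrow> 'a virtual_rack set set" where
  "virtual_quandle_classes Q =
     virtual_quandles_over Q //
       {(V, W). V \<in> virtual_quandles_over Q \<and> W \<in> virtual_quandles_over Q \<and>
                virtual_rack_isomorphic V W}"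

end

theory Submission imports Defs begin

text \<open>
  The isomorphism classes of virtual quandles over a quandle \<open>Q\<close> are the conjugacy classes of
  \<open>Aut Q\<close>: a virtual quandle over \<open>Q\<close> can be transported along an isomorphism of its underlying
  quandle with \<open>Q\<close>, and an isomorphism from \<open>(Q, f)\<close> to \<open>(Q, g)\<close> is an automorphism of \<open>Q\<close> that
  conjugates \<open>f\<close> into \<open>g\<close>.

  For the dihedral quandle of order \<open>n\<close>, the automorphisms are the affine maps \<open>x \<mapsto> a * x + b\<close> of
  the integers modulo \<open>n\<close> with \<open>a\<close> a unit (\<open>rack_iso_dihedral_affine\<close>): as \<open>x + 2 = 2 (x + 1) - x\<close>,
  a homomorphism sends consecutive residues to an arithmetic progression. Conjugation by
  \<open>x \<mapsto> u * x + c\<close> keeps \<open>a\<close> and replaces \<open>b\<close> by \<open>u * b + (1 - a) * c\<close>. So for fixed \<open>a\<close> the classes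
  are the orbits of the units modulo \<open>n\<close> on the residues \<open>b\<close> modulo \<open>m = gcd (a - 1) n\<close>. Units lift
  along the divisor \<open>m\<close> of \<open>n\<close> (\<open>coprime_lift\<close>), so these orbits are classified by \<open>gcd b m\<close>, which
  takes as values exactly the divisors of \<open>m\<close>
  (\<open>affine_virtual_isomorphic_normal_form\<close>, \<open>affine_params_inj\<close>).

  Hence the classes correspond to the pairs of a unit \<open>a\<close> modulo \<open>n\<close> and a common divisor \<open>d\<close> of
  \<open>n\<close> and \<open>a - 1\<close>. Counting these pairs by \<open>d\<close> instead, the units congruent to 1 modulo \<open>d\<close> form the
  kernel of the surjective reduction from units modulo \<open>n\<close> to units modulo \<open>d\<close>, which has
  \<open>totient n / totient d\<close> elements (\<open>card_units_mod_cong_1\<close>).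
\<close>

section \<open>Units modulo an integer\<close>

text \<open>
  Residues are represented in \<open>{0..<n}\<close>, the carrier of the dihedral quandle, whereas \<open>totatives n\<close>
  lies in \<open>{0<..n}\<close>. The two conventions differ for \<open>n = 1\<close>, where the only unit here is 0.
\<close>

definition units_mod :: "nat \<Rightarrow> int set" where
  "units_mod n = {a \<in> {0..<int n}. coprime a (int n)}"

lemma finite_units_mod [simp]: "finite (units_mod n)"
  by (rule finite_subset[of _ "{0..<int n}"]) (auto simp: units_mod_def)

lemma card_units_mod:
  assumes "n > 0"
  shows "card (units_mod n) = totient n"
proof -
  have "bij_betw (\<lambda>k. int k mod int n) (totatives n) (units_mod n)"
  proof (rule bij_betwI')
    fix x y assume xy: "x \<in> totatives n" "y \<in> totatives n"
    show "(int x mod int n = int y mod int n) = (x = y)"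
    proof
      assume "int x mod int n = int y mod int n"
      then have "x mod n = y mod n"
        by (metis of_nat_eq_iff zmod_int)
      moreover have "x > 0" "x \<le> n" "y > 0" "y \<le> n"
        using xy by (auto simp: in_totatives_iff)
      ultimately show "x = y"
        by (cases "x = n"; cases "y = n") auto
    qed simp
  next
    fix x assume "x \<in> totatives n"
    then show "int x mod int n \<in> units_mod n"
      using assms by (auto simp: units_mod_def in_totatives_iff)
  next
    fix a assume a: "a \<in> units_mod n"
    show "\<exists>x\<in>totatives n. a = int x mod int n"
    proof (cases "a = 0")
      case True
      then have "n = 1" using a by (auto simp: units_mod_def)
      then show ?thesis using True by simp
    next
      case False
      then have "nat a \<in> totatives n" "a = int (nat a) mod int n"
        using a by (auto simp: units_mod_def in_totatives_iff coprime_int_iff[symmetric])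
      then show ?thesis by blast
    qed
  qed
  then show ?thesis
    by (simp add: bij_betw_same_card totient_def)
qed

text \<open>
  A unit modulo \<open>k\<close> lifts to a unit modulo \<open>n\<close>. Take for \<open>t\<close> the product of the primes dividing
  \<open>n\<close> but not \<open>x\<close>: each prime divisor of \<open>n\<close> then divides exactly one of \<open>x\<close> and \<open>t\<close>, and those
  dividing \<open>x\<close> cannot divide \<open>k\<close>, so none divides \<open>x + t * k\<close>.
\<close>

lemma coprime_lift:
  fixes x k n :: int
  assumes "coprime x k" "n \<noteq> 0"
  obtains t where "coprime (x + t * k) n"
proof
  define t where "t = \<Prod>{p \<in> prime_factors n. \<not> p dvd x}"
  show "coprime (x + t * k) n"
  proof (rule ccontr)
    assume "\<not> coprime (x + t * k) n"
    then have "gcd (x + t * k) n \<noteq> 0" "\<not> is_unit (gcd (x + t * k) n)"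
      using assms(2) by (auto simp: coprime_iff_gcd_eq_1)
    then obtain p where p: "prime p" "p dvd gcd (x + t * k) n"
      using prime_divisorE by blast
    then have pf: "p \<in> prime_factors n" and d: "p dvd x + t * k"
      using assms(2) by (auto simp: prime_factors_dvd)
    have t_iff: "p dvd t \<longleftrightarrow> \<not> p dvd x"
    proof -
      have "p dvd t \<longleftrightarrow> (\<exists>q\<in>{p \<in> prime_factors n. \<not> p dvd x}. p dvd q)"
        unfolding t_def using p(1) by (subst prime_dvd_prod_iff) auto
      also have "\<dots> \<longleftrightarrow> \<not> p dvd x"
        using pf p(1) by (auto dest: primes_dvd_imp_eq in_prime_factors_imp_prime)
      finally show ?thesis .
    qed
    show False
    proof (cases "p dvd x")
      case True
      then have "p dvd t * k"
        using d by (simp add: dvd_add_right_iff)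
      then have "p dvd k"
        using p(1) t_iff True by (simp add: prime_dvd_mult_iff)
      then show False
        using True assms(1) p(1) not_prime_unit coprime_common_divisor by blast
    next
      case False
      then show False
        using t_iff d by (simp add: dvd_add_left_iff)
    qed
  qed
qed

text \<open>
  All fibres of the reduction from units modulo \<open>n\<close> to units modulo \<open>d\<close> have the same size:
  multiplication by a lift \<open>u\<close> of \<open>c\<close> maps the fibre over 1 onto the fibre over \<open>c\<close>.
\<close>

lemma card_units_mod_cong_1:
  assumes "n > 0" "d dvd n"
  shows "card {a \<in> units_mod n. int d dvd a - 1} * totient d = totient n"
proof -
  have d: "d > 0" using assms by (auto intro: Nat.gr0I)
  let ?r = "\<lambda>a. a mod int d"
  have dn: "int d dvd int n" using assms(2) by simp
  have fibre: "card {a \<in> units_mod n. ?r a = c} = card {a \<in> units_mod n. int d dvd a - 1}"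
    if c: "c \<in> units_mod d" for c
  proof -
    obtain t where t: "coprime (c + t * int d) (int n)"
      using coprime_lift[of c "int d" "int n"] c assms(1) by (auto simp: units_mod_def)
    define u where "u = c + t * int d"
    have u: "coprime u (int n)" "u mod int d = c"
      using t c by (auto simp: u_def units_mod_def)
    obtain v where v: "[u * v = 1] (mod int n)"
      using u(1) coprime_iff_invertible_int by blast
    then have v': "coprime v (int n)"
      by (metis coprime_iff_invertible_int mult.commute)
    have ud: "[u * v = 1] (mod int d)"
      using v dn cong_dvd_modulus by blast
    have uc: "[u = c] (mod int d)"
      using u(2) by (auto simp: cong_def)
    have "bij_betw (\<lambda>a. (u * a) mod int n) {a \<in> units_mod n. int d dvd a - 1}
            {a \<in> units_mod n. ?r a = c}"
    proof (rule bij_betw_byWitness[where f' = "\<lambda>a. (v * a) mod int n"])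
      have "v * (u * a mod int n) mod int n = a" if "a \<in> units_mod n" for a
      proof -
        have "[v * (u * a mod int n) = (u * v) * a] (mod int n)"
          by (simp add: cong_def mod_mult_right_eq ac_simps)
        also have "[(u * v) * a = 1 * a] (mod int n)"
          using v by (rule cong_scalar_right)
        finally show ?thesis
          using that by (simp add: cong_def units_mod_def)
      qed
      then show "\<forall>a\<in>{a \<in> units_mod n. int d dvd a - 1}. v * (u * a mod int n) mod int n = a"
        by blast
      have "u * (v * a mod int n) mod int n = a" if "a \<in> units_mod n" for a
      proof -
        have "[u * (v * a mod int n) = (u * v) * a] (mod int n)"
          by (simp add: cong_def mod_mult_right_eq ac_simps)
        also have "[(u * v) * a = 1 * a] (mod int n)"
          using v by (rule cong_scalar_right)
        finally show ?thesis
          using that by (simp add: cong_def units_mod_def)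
      qed
      then show "\<forall>a\<in>{a \<in> units_mod n. ?r a = c}. u * (v * a mod int n) mod int n = a"
        by blast
      show "(\<lambda>a. u * a mod int n) ` {a \<in> units_mod n. int d dvd a - 1}
              \<subseteq> {a \<in> units_mod n. ?r a = c}"
      proof safe
        fix a assume a: "a \<in> units_mod n" "int d dvd a - 1"
        show "u * a mod int n \<in> units_mod n"
          using a u assms(1) by (auto simp: units_mod_def)
        have "[u * a = c * 1] (mod int d)"
          using uc a(2) by (intro cong_mult) (auto simp: cong_iff_dvd_diff)
        then show "u * a mod int n mod int d = c"
          using c dn by (simp add: mod_mod_cancel cong_def units_mod_def)
      qed
      show "(\<lambda>a. v * a mod int n) ` {a \<in> units_mod n. ?r a = c}
              \<subseteq> {a \<in> units_mod n. int d dvd a - 1}"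
      proof safe
        fix a assume a: "a \<in> units_mod n" "c = ?r a"
        show "v * a mod int n \<in> units_mod n"
          using a v' assms(1) by (auto simp: units_mod_def)
        have "[v * a = v * u] (mod int d)"
          using uc a(2) by (intro cong_mult) (auto simp: cong_def)
        also have "[v * u = 1] (mod int d)"
          using ud by (simp add: ac_simps)
        finally have "[v * a mod int n = 1] (mod int d)"
          using dn by (simp add: cong_def mod_mod_cancel)
        then show "int d dvd v * a mod int n - 1"
          by (simp add: cong_iff_dvd_diff)
      qed
    qed
    then show ?thesis by (simp add: bij_betw_same_card)
  qed
  have sub: "?r ` units_mod n \<subseteq> units_mod d"
    using d coprime_divisors[OF dvd_refl dn] by (auto simp: units_mod_def)
  have "totient n = (\<Sum>a\<in>units_mod n. 1)"
    by (simp add: card_units_mod assms(1))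
  also have "\<dots> = (\<Sum>c\<in>units_mod d. \<Sum>a | a \<in> units_mod n \<and> ?r a = c. 1)"
    using sub by (subst sum.group) auto
  also have "\<dots> = (\<Sum>c\<in>units_mod d. card {a \<in> units_mod n. int d dvd a - 1})"
    using fibre by (intro sum.cong) simp_all
  also have "\<dots> = card {a \<in> units_mod n. int d dvd a - 1} * totient d"
    by (simp add: card_units_mod d)
  finally show ?thesis ..
qed

text \<open>
  The pair \<open>(a, d)\<close> stands for the conjugacy class of the affine map \<open>x \<mapsto> a * x + d\<close>.
\<close>

definition affine_params :: "nat \<Rightarrow> (int \<times> nat) set" where
  "affine_params n = (SIGMA a : units_mod n. {d. d dvd n \<and> int d dvd a - 1})"

text \<open>
  Double counting: the sum over units \<open>a\<close> of the number of admissible \<open>d\<close> is rearranged into a sum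
  over the divisors \<open>d\<close> of \<open>n\<close>.
\<close>

lemma card_affine_params:
  assumes "n > 0"
  shows "real (card (affine_params n)) = real (totient n) * (\<Sum>d | d dvd n. 1 / real (totient d))"
proof -
  have fin: "finite {d. d dvd n}" using assms by simp
  have "card (affine_params n) = (\<Sum>a\<in>units_mod n. card {d. d dvd n \<and> int d dvd a - 1})"
    unfolding affine_params_def
    by (rule card_SigmaI) (auto intro: finite_subset[OF _ fin])
  also have "\<dots> = (\<Sum>a\<in>units_mod n. \<Sum>d | d dvd n. if int d dvd a - 1 then 1 else 0)"
    using fin by (simp flip: sum.inter_filter)
  also have "\<dots> = (\<Sum>d | d dvd n. \<Sum>a\<in>units_mod n. if int d dvd a - 1 then 1 else 0)"
    by (rule sum.swap)
  also have "\<dots> = (\<Sum>d | d dvd n. card {a \<in> units_mod n. int d dvd a - 1})"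
    by (simp flip: sum.inter_filter)
  finally have "real (card (affine_params n)) =
      (\<Sum>d | d dvd n. real (card {a \<in> units_mod n. int d dvd a - 1}))" by simp
  also have "\<dots> = (\<Sum>d | d dvd n. real (totient n) * (1 / real (totient d)))"
  proof (rule sum.cong)
    fix d assume "d \<in> {d. d dvd n}"
    then have "d dvd n" "totient d > 0" using assms by (auto intro: Nat.gr0I)
    moreover have "real (card {a \<in> units_mod n. int d dvd a - 1}) * real (totient d) = real (totient n)"
      using card_units_mod_cong_1[OF assms \<open>d dvd n\<close>] by (metis of_nat_mult)
    ultimately show "real (card {a \<in> units_mod n. int d dvd a - 1}) = real (totient n) * (1 / real (totient d))"
      by (simp add: field_simps)
  qed simp
  finally show ?thesis by (simp add: sum_distrib_left)
qed

section \<open>Virtual racks up to isomorphism\<close>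

lemma is_rack_iff:
  "is_rack R \<longleftrightarrow> act R \<in> extensional (carrier R) \<and> (\<forall>x\<in>carrier R. act R x \<in> Bij (carrier R)) \<and>
     (\<forall>x\<in>carrier R. \<forall>y\<in>carrier R. \<forall>z\<in>carrier R.
        act R x (act R y z) = act R (act R x y) (act R x z))"
  unfolding is_rack_def compose_def
  by (auto simp: PiE_def Pi_def fun_eq_iff restrict_def split: if_splits)

lemma act_closed: "is_rack R \<Longrightarrow> x \<in> carrier R \<Longrightarrow> y \<in> carrier R \<Longrightarrow> act R x y \<in> carrier R"
  using Bij_imp_funcset by (fastforce simp: is_rack_iff)

lemma rack_iso_iff:
  "\<psi> \<in> rack_iso R S \<longleftrightarrow> bij_betw \<psi> (carrier R) (carrier S) \<and>
     (\<forall>x\<in>carrier R. \<forall>y\<in>carrier R. \<psi> (act R x y) = act S (\<psi> x) (\<psi> y))"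
  by (auto simp: rack_iso_def rack_hom_def bij_betw_def)

lemma virtual_rack_iso_iff:
  "\<psi> \<in> virtual_rack_iso V W \<longleftrightarrow> \<psi> \<in> rack_iso (fst V) (fst W) \<and>
     (\<forall>x\<in>carrier (fst V). \<psi> (snd V x) = snd W (\<psi> x))"
  by (auto simp: virtual_rack_iso_def virtual_rack_hom_def rack_iso_def)

lemma rack_iso_comp:
  "\<psi> \<in> rack_iso R S \<Longrightarrow> \<chi> \<in> rack_iso S T \<Longrightarrow> \<chi> \<circ> \<psi> \<in> rack_iso R T"
  by (auto simp: rack_iso_iff intro: bij_betw_trans dest: bij_betwE)

lemma rack_iso_inv:
  assumes "is_rack R" "\<psi> \<in> rack_iso R S"
  shows "inv_into (carrier R) \<psi> \<in> rack_iso S R"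
proof -
  let ?i = "inv_into (carrier R) \<psi>"
  have b: "bij_betw \<psi> (carrier R) (carrier S)"
    and h: "\<And>x y. x \<in> carrier R \<Longrightarrow> y \<in> carrier R \<Longrightarrow> \<psi> (act R x y) = act S (\<psi> x) (\<psi> y)"
    using assms(2) by (auto simp: rack_iso_iff)
  have bi: "bij_betw ?i (carrier S) (carrier R)" using b by (rule bij_betw_inv_into)
  have "?i (act S x y) = act R (?i x) (?i y)" if xy: "x \<in> carrier S" "y \<in> carrier S" for x y
  proof -
    have i: "?i x \<in> carrier R" "?i y \<in> carrier R" using bi xy by (auto dest: bij_betwE)
    have "act S x y = \<psi> (act R (?i x) (?i y))"
      using h[OF i] xy b by (simp add: bij_betw_inv_into_right)
    then show ?thesis
      using bij_betw_inv_into_left[OF b] act_closed[OF assms(1) i] by simp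
  qed
  with bi show ?thesis by (auto simp: rack_iso_iff)
qed

lemma rack_auto_closed: "f \<in> rack_auto R \<Longrightarrow> x \<in> carrier R \<Longrightarrow> f x \<in> carrier R"
  by (auto simp: rack_auto_def Bij_def dest: bij_betwE)

text \<open>
  Transitivity and symmetry are needed for virtual racks over different types, because an abstract
  virtual quandle is compared with one on residues modulo \<open>n\<close>.
\<close>

lemma virtual_rack_isomorphic_trans:
  assumes "virtual_rack_isomorphic U V" "virtual_rack_isomorphic V W"
  shows "virtual_rack_isomorphic U W"
proof -
  obtain \<psi> \<chi> where p: "\<psi> \<in> virtual_rack_iso U V" "\<chi> \<in> virtual_rack_iso V W"
    using assms by (auto simp: virtual_rack_isomorphic_def)
  have "\<psi> x \<in> carrier (fst V)" if "x \<in> carrier (fst U)" for x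
    using p(1) that by (auto simp: virtual_rack_iso_iff rack_iso_iff dest: bij_betwE)
  then have "\<chi> \<circ> \<psi> \<in> virtual_rack_iso U W"
    using p rack_iso_comp by (auto simp: virtual_rack_iso_iff)
  then show ?thesis by (auto simp: virtual_rack_isomorphic_def)
qed

lemma virtual_rack_isomorphic_sym:
  assumes V: "is_virtual_rack V" and "virtual_rack_isomorphic V W"
  shows "virtual_rack_isomorphic W V"
proof -
  obtain \<psi> where p: "\<psi> \<in> virtual_rack_iso V W"
    using assms by (auto simp: virtual_rack_isomorphic_def)
  let ?i = "inv_into (carrier (fst V)) \<psi>"
  have b: "bij_betw \<psi> (carrier (fst V)) (carrier (fst W))"
    using p by (auto simp: virtual_rack_iso_iff rack_iso_iff)
  have "?i (snd W x) = snd V (?i x)" if x: "x \<in> carrier (fst W)" for x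
  proof -
    have i: "?i x \<in> carrier (fst V)"
      using bij_betw_inv_into[OF b] x by (auto dest: bij_betwE)
    then have "snd W x = \<psi> (snd V (?i x))"
      using p x b by (simp add: virtual_rack_iso_iff bij_betw_inv_into_right)
    moreover have "snd V (?i x) \<in> carrier (fst V)"
      using V i by (auto simp: is_virtual_rack_def intro: rack_auto_closed)
    ultimately show ?thesis
      using bij_betw_inv_into_left[OF b] by simp
  qed
  moreover have "?i \<in> rack_iso (fst W) (fst V)"
    using V p by (auto simp: is_virtual_rack_def virtual_rack_iso_iff intro: rack_iso_inv)
  ultimately have "?i \<in> virtual_rack_iso W V"
    by (simp add: virtual_rack_iso_iff)
  then show ?thesis by (auto simp: virtual_rack_isomorphic_def)
qed

text \<open>
  The transported automorphism is the conjugate of \<open>f\<close> by \<open>\<psi>\<close>, cut down to the carrier of \<open>S\<close>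
  because automorphisms are extensional functions.
\<close>

lemma transport_automorphism:
  assumes "is_rack R" "is_rack S" "\<psi> \<in> rack_iso R S" "f \<in> rack_auto R"
  obtains g where "g \<in> rack_auto S" "virtual_rack_isomorphic (R, f) (S, g)"
proof
  let ?i = "inv_into (carrier R) \<psi>"
  define g where "g = restrict (\<psi> \<circ> f \<circ> ?i) (carrier S)"
  have "f \<in> rack_iso R R" using assms(4) by (simp add: rack_auto_def)
  then have "\<psi> \<circ> (f \<circ> ?i) \<in> rack_iso S S"
    by (intro rack_iso_comp[OF _ assms(3)] rack_iso_comp[OF rack_iso_inv[OF assms(1,3)]])
  then have "g \<in> rack_iso S S"
    using act_closed[OF assms(2)] by (simp add: rack_iso_iff g_def comp_assoc)
  then show "g \<in> rack_auto S"
    by (auto simp: rack_auto_def Bij_def g_def rack_iso_iff)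
  have b: "bij_betw \<psi> (carrier R) (carrier S)" using assms(3) by (auto simp: rack_iso_iff)
  then have "\<psi> \<in> virtual_rack_iso (R, f) (S, g)"
    using assms(3) by (auto simp: virtual_rack_iso_iff g_def bij_betw_inv_into_left dest: bij_betwE)
  then show "virtual_rack_isomorphic (R, f) (S, g)"
    by (auto simp: virtual_rack_isomorphic_def)
qed

text \<open>
  Transport of structure along a bijection serves to find copies of a dihedral quandle inside any
  infinite type.
\<close>

lemma transport_quandle:
  fixes R :: "'b rack" and \<psi> :: "'b \<Rightarrow> 'a"
  assumes "is_quandle R" "bij_betw \<psi> (carrier R) Y"
  obtains S :: "'a rack" where "is_quandle S" "\<psi> \<in> rack_iso R S"
proof
  let ?i = "inv_into (carrier R) \<psi>"
  define S :: "'a rack"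
    where "S = \<lparr>carrier = Y, act = (\<lambda>x\<in>Y. \<lambda>y\<in>Y. \<psi> (act R (?i x) (?i y)))\<rparr>"
  have R: "is_rack R" and q: "\<And>x. x \<in> carrier R \<Longrightarrow> act R x x = x"
    using assms(1) by (auto simp: is_quandle_def)
  have bi: "bij_betw ?i Y (carrier R)" using assms(2) by (rule bij_betw_inv_into)
  have iY [simp]: "?i y \<in> carrier R" if "y \<in> Y" for y using bi that by (auto dest: bij_betwE)
  have pR [simp]: "\<psi> x \<in> Y" if "x \<in> carrier R" for x using assms(2) that by (auto dest: bij_betwE)
  note [simp] = bij_betw_inv_into_left[OF assms(2)] bij_betw_inv_into_right[OF assms(2)]
    act_closed[OF R]
  have bij: "restrict (\<lambda>y. \<psi> (act R (?i x) (?i y))) Y \<in> Bij Y" if "x \<in> Y" for x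
  proof -
    have "bij_betw (act R (?i x)) (carrier R) (carrier R)"
      using R that by (auto simp: is_rack_iff Bij_def)
    then have "bij_betw (\<psi> \<circ> (act R (?i x) \<circ> ?i)) Y Y"
      using bi assms(2) by (blast intro: bij_betw_trans)
    then show ?thesis by (auto simp: Bij_def comp_def)
  qed
  have dist: "act R x (act R y z) = act R (act R x y) (act R x z)"
    if "x \<in> carrier R" "y \<in> carrier R" "z \<in> carrier R" for x y z
    using R that unfolding is_rack_iff by blast
  have cS: "carrier S = Y" and aS: "\<And>x. x \<in> Y \<Longrightarrow> act S x = (\<lambda>y\<in>Y. \<psi> (act R (?i x) (?i y)))"
    and eS: "act S \<in> extensional Y"
    by (simp_all add: S_def)
  have "act S x (act S y z) = act S (act S x y) (act S x z)"
    if "x \<in> Y" "y \<in> Y" "z \<in> Y" for x y z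
    using that dist[of "?i x" "?i y" "?i z"] by (simp add: aS)
  then show "is_quandle S"
    unfolding is_quandle_def is_rack_iff cS using eS bij by (simp add: aS q)
  show "\<psi> \<in> rack_iso R S"
    using assms(2) by (auto simp: rack_iso_iff S_def)
qed

section \<open>Automorphisms of dihedral quandles\<close>

definition affine_map :: "nat \<Rightarrow> int \<Rightarrow> int \<Rightarrow> int \<Rightarrow> int" where
  "affine_map n a b = (\<lambda>x\<in>{0..<int n}. (a * x + b) mod int n)"

lemma carrier_dihedral [simp]: "carrier (dihedral_quandle n) = {0..<int n}"
  by (simp add: dihedral_quandle_def)

lemma act_dihedral:
  "x \<in> {0..<int n} \<Longrightarrow> y \<in> {0..<int n} \<Longrightarrow> act (dihedral_quandle n) x y = (2 * x - y) mod int n"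
  by (simp add: dihedral_quandle_def)

lemma affine_map_Bij:
  assumes "coprime a (int n)"
  shows "affine_map n a b \<in> Bij {0..<int n}"
proof -
  have "inj_on (affine_map n a b) {0..<int n}"
  proof (rule inj_onI)
    fix x y assume xy: "x \<in> {0..<int n}" "y \<in> {0..<int n}" "affine_map n a b x = affine_map n a b y"
    then have "[a * x + b = a * y + b] (mod int n)"
      by (simp add: affine_map_def cong_def)
    then have "[x = y] (mod int n)"
      using assms by (simp add: cong_add_rcancel cong_mult_lcancel)
    then show "x = y" using xy by (simp add: cong_def)
  qed
  moreover have "affine_map n a b ` {0..<int n} \<subseteq> {0..<int n}"
    by (auto simp: affine_map_def)
  ultimately have "bij_betw (affine_map n a b) {0..<int n} {0..<int n}"
    by (simp add: bij_betw_def endo_inj_surj)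
  then show ?thesis by (simp add: Bij_def affine_map_def)
qed

lemma is_quandle_dihedral: "is_quandle (dihedral_quandle n)"
proof -
  let ?Q = "dihedral_quandle n"
  have bij: "act ?Q x \<in> Bij (carrier ?Q)" if "x \<in> carrier ?Q" for x
  proof -
    \<comment> \<open>the inner operations are themselves affine maps, namely reflections\<close>
    have "act ?Q x = affine_map n (-1) (2 * x)"
      using that by (auto simp: dihedral_quandle_def affine_map_def)
    then show ?thesis by (simp add: affine_map_Bij)
  qed
  have cl: "a mod int n \<in> {0..<int n}" if "z \<in> {0..<int n}" for a z
    using that by auto
  have dist: "act ?Q x (act ?Q y z) = act ?Q (act ?Q x y) (act ?Q x z)"
    if "x \<in> carrier ?Q" "y \<in> carrier ?Q" "z \<in> carrier ?Q" for x y z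
  proof -
    have "[2 * x - (2 * y - z) mod int n = 2 * x - (2 * y - z)] (mod int n)"
      by (intro cong_diff cong_refl) simp
    also have "2 * x - (2 * y - z) = 2 * (2 * x - y) - (2 * x - z)" by simp
    also have "[2 * (2 * x - y) - (2 * x - z)
        = 2 * ((2 * x - y) mod int n) - (2 * x - z) mod int n] (mod int n)"
      by (intro cong_diff cong_mult cong_refl) simp_all
    finally have "(2 * x - (2 * y - z) mod int n) mod int n
        = (2 * ((2 * x - y) mod int n) - (2 * x - z) mod int n) mod int n"
      by (simp only: cong_def)
    then show ?thesis
      using that cl[of z] by (simp add: act_dihedral)
  qed
  have "act ?Q \<in> extensional (carrier ?Q)" by (simp add: dihedral_quandle_def)
  moreover have "act ?Q x x = x" if "x \<in> carrier ?Q" for x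
    using that by (simp add: act_dihedral)
  ultimately show ?thesis
    using bij dist unfolding is_quandle_def is_rack_iff by blast
qed

lemma is_rack_dihedral: "is_rack (dihedral_quandle n)"
  using is_quandle_dihedral by (simp add: is_quandle_def)

lemma affine_map_auto:
  assumes "coprime a (int n)"
  shows "affine_map n a b \<in> rack_auto (dihedral_quandle n)"
proof -
  have "affine_map n a b (act (dihedral_quandle n) x y) =
      act (dihedral_quandle n) (affine_map n a b x) (affine_map n a b y)"
    if "x \<in> {0..<int n}" "y \<in> {0..<int n}" for x y
  proof -
    have "[a * ((2 * x - y) mod int n) + b = a * (2 * x - y) + b] (mod int n)"
      by (intro cong_add cong_mult cong_refl) simp
    also have "a * (2 * x - y) + b = 2 * (a * x + b) - (a * y + b)"
      by (simp add: algebra_simps)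
    also have "[2 * (a * x + b) - (a * y + b)
       = 2 * ((a * x + b) mod int n) - (a * y + b) mod int n] (mod int n)"
      by (intro cong_diff cong_mult cong_refl) simp_all
    finally have "(a * ((2 * x - y) mod int n) + b) mod int n
       = (2 * ((a * x + b) mod int n) - (a * y + b) mod int n) mod int n"
      by (simp only: cong_def)
    moreover have "c mod int n \<in> {0..<int n}" for c using that by auto
    ultimately show ?thesis
      using that by (simp add: act_dihedral affine_map_def)
  qed
  then show ?thesis
    using affine_map_Bij[OF assms] by (auto simp: rack_auto_def rack_iso_iff Bij_def)
qed

text \<open>
  The operation sends \<open>k + 1\<close> and \<open>k\<close> to \<open>k + 2\<close>, so the values of \<open>\<psi>\<close> satisfy the recurrence of an
  arithmetic progression and are determined by the first two of them. The slope is a unit because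
  \<open>\<psi>\<close> is surjective.
\<close>

lemma rack_iso_dihedral_affine:
  assumes "n > 0" and iso: "\<psi> \<in> rack_iso (dihedral_quandle n) (dihedral_quandle n)"
  obtains a b where "a \<in> units_mod n" "\<And>x. x \<in> {0..<int n} \<Longrightarrow> \<psi> x = (a * x + b) mod int n"
proof -
  have bij: "bij_betw \<psi> {0..<int n} {0..<int n}"
    and hom: "\<And>x y. x \<in> {0..<int n} \<Longrightarrow> y \<in> {0..<int n} \<Longrightarrow>
       \<psi> ((2 * x - y) mod int n) = act (dihedral_quandle n) (\<psi> x) (\<psi> y)"
    using iso act_dihedral[of _ n] by (auto simp: rack_iso_iff)
  have range: "\<psi> x \<in> {0..<int n}" if "x \<in> {0..<int n}" for x
    using bij that by (auto dest: bij_betwE)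
  define b where "b = \<psi> 0"
  \<comment> \<open>for \<open>n = 1\<close> the residue of 1 is 0, since 1 is outside the carrier\<close>
  define a where "a = (\<psi> (1 mod int n) - b) mod int n"
  have cong: "int k < int n \<Longrightarrow> [\<psi> (int k) = a * int k + b] (mod int n)" for k
  proof (induction k rule: less_induct)
    case (less k)
    consider "k = 0" | "k = 1" | j where "k = Suc (Suc j)"
      by (metis One_nat_def not0_implies_Suc)
    then show ?case
    proof cases
      case 1
      then show ?thesis by (simp add: b_def)
    next
      case 2
      then show ?thesis using less.prems by (simp add: a_def cong_def mod_simps)
    next
      case (3 j)
      have k: "(2 * int (Suc j) - int j) mod int n = int k"
        using 3 less.prems by simp
      have "\<psi> (int k) = (2 * \<psi> (int (Suc j)) - \<psi> (int j)) mod int n"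
        using hom[of "int (Suc j)" "int j"] 3 less.prems range unfolding k
        by (simp add: act_dihedral)
      then have "[\<psi> (int k) = 2 * \<psi> (int (Suc j)) - \<psi> (int j)] (mod int n)"
        by simp
      also have "[2 * \<psi> (int (Suc j)) - \<psi> (int j) =
           2 * (a * int (Suc j) + b) - (a * int j + b)] (mod int n)"
        using 3 less.prems by (intro cong_diff cong_mult cong_refl less.IH) auto
      also have "2 * (a * int (Suc j) + b) - (a * int j + b) = a * int k + b"
        using 3 by (simp add: algebra_simps)
      finally show ?thesis .
    qed
  qed
  have eq: "\<psi> x = (a * x + b) mod int n" if "x \<in> {0..<int n}" for x
    using cong[of "nat x"] range[OF that] that by (simp add: cong_def)
  \<comment> \<open>a preimage of \<open>b + 1\<close> is an inverse of the slope\<close>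
  have "(b + 1) mod int n \<in> {0..<int n}" using assms(1) by simp
  then obtain x where "x \<in> {0..<int n}" "\<psi> x = (b + 1) mod int n"
    using bij unfolding bij_betw_def by (metis (no_types, lifting) imageE)
  then have "[a * x + b = 1 + b] (mod int n)"
    using eq by (simp add: cong_def add.commute)
  then have "[a * x = 1] (mod int n)" by (simp only: cong_add_rcancel)
  then have "coprime a (int n)" using coprime_iff_invertible_int by blast
  moreover have "a \<in> {0..<int n}" using assms(1) by (simp add: a_def)
  ultimately have "a \<in> units_mod n" by (simp add: units_mod_def)
  then show ?thesis using that eq by blast
qed

section \<open>Conjugacy of affine maps\<close>

text \<open>
  A unit \<open>u\<close> with \<open>u * b = d\<close> modulo \<open>m\<close>, where \<open>d\<close> is the gcd of \<open>b\<close> and \<open>m\<close>, comes from a Bezout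
  identity for \<open>b\<close> and \<open>m\<close>: the Bezout coefficient \<open>x\<close> of \<open>b\<close> is a unit modulo \<open>m div d\<close>, and adding
  multiples of \<open>m div d\<close> to it does not change \<open>x * b\<close> modulo \<open>m\<close>, so it can be lifted to a unit
  modulo \<open>n\<close>. The remaining error \<open>d - u * b\<close> is a multiple of \<open>m\<close>, hence modulo \<open>n\<close> a multiple of
  \<open>a - 1\<close>, which a translation by \<open>c\<close> absorbs.
\<close>

lemma affine_virtual_isomorphic_normal_form:
  assumes "n > 0" "coprime a (int n)"
  shows "virtual_rack_isomorphic (dihedral_quandle n, affine_map n a b)
           (dihedral_quandle n, affine_map n a (gcd b (gcd (a - 1) (int n))))"
proof -
  define m where "m = gcd (a - 1) (int n)"
  define d where "d = gcd b m"
  have m: "m > 0" "m dvd int n" using assms(1) by (auto simp: m_def)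
  have d: "d > 0" "d dvd b" "d dvd m" using m by (auto simp: d_def)
  obtain x y where xy: "x * b + y * m = d"
    using bezout_int unfolding d_def by blast
  have "d * (x * (b div d) + y * (m div d)) = d * 1"
    using d xy by (simp add: distrib_left mult.left_commute[of d])
  then have "x * (b div d) + y * (m div d) = 1"
    using d by simp
  then have "[x * (b div d) = 1] (mod (m div d))"
    by (metis cong_iff_lin add.commute mult.commute cong_sym)
  then have "coprime x (m div d)"
    using coprime_iff_invertible_int by blast
  then obtain t where "coprime (x + t * (m div d)) (int n)"
    using coprime_lift[of x "m div d" "int n"] assms(1) by auto
  moreover define u where "u = x + t * (m div d)"
  ultimately have u: "coprime u (int n)" by simp
  have "u * b = x * b + t * (b div d) * m"
    using d by (auto simp: u_def algebra_simps elim!: dvdE)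
  then have "d - u * b = m * (y - t * (b div d))"
    using xy by (simp add: algebra_simps)
  moreover obtain r s where "r * (a - 1) + s * int n = m"
    using bezout_int unfolding m_def by blast
  moreover define w where "w = y - t * (b div d)"
  ultimately have "d - u * b = (r * (a - 1) + s * int n) * w" by simp
  moreover define c where "c = - r * w"
  ultimately have "u * b + c - (a * c + d) = int n * (- s * w)"
    by (simp add: algebra_simps)
  then have key: "[u * b + c = a * c + d] (mod int n)"
    by (simp add: cong_iff_dvd_diff)
  have "affine_map n u c (affine_map n a b x) = affine_map n a d (affine_map n u c x)"
    if "x \<in> {0..<int n}" for x
  proof -
    have "[u * (a * x + b) + c = u * a * x + (u * b + c)] (mod int n)"
      by (simp add: algebra_simps)
    also have "[u * a * x + (u * b + c) = u * a * x + (a * c + d)] (mod int n)"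
      using key by (simp add: cong_add_lcancel)
    also have "u * a * x + (a * c + d) = a * (u * x + c) + d"
      by (simp add: algebra_simps)
    finally have "[u * (a * x + b) + c = a * (u * x + c) + d] (mod int n)" .
    moreover have "[u * ((a * x + b) mod int n) + c = u * (a * x + b) + c] (mod int n)"
      "[a * (u * x + c) + d = a * ((u * x + c) mod int n) + d] (mod int n)"
      by (intro cong_add cong_mult cong_refl; simp)+
    ultimately have "(u * ((a * x + b) mod int n) + c) mod int n
        = (a * ((u * x + c) mod int n) + d) mod int n"
      by (metis cong_def)
    moreover have "e mod int n \<in> {0..<int n}" for e using assms(1) by auto
    ultimately show ?thesis
      using that by (simp add: affine_map_def)
  qed
  moreover have "affine_map n u c \<in> rack_iso (dihedral_quandle n) (dihedral_quandle n)"
    using affine_map_auto[OF u] by (simp add: rack_auto_def)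
  ultimately have "affine_map n u c \<in> virtual_rack_iso (dihedral_quandle n, affine_map n a b)
       (dihedral_quandle n, affine_map n a d)"
    by (simp add: virtual_rack_iso_iff)
  then show ?thesis
    by (auto simp: virtual_rack_isomorphic_def d_def m_def)
qed

text \<open>
  Evaluating the conjugation identity at 0 and at 1 shows that the slope is invariant and that
  \<open>b' = u * b + (1 - a) * c\<close> modulo \<open>n\<close>. The last term vanishes modulo every common divisor of \<open>n\<close> and \<open>a - 1\<close>,
  so that divisibility of \<open>b\<close> by such a divisor is invariant as well.
\<close>

lemma affine_virtual_isomorphic_dvd:
  assumes "n > 0" and "virtual_rack_isomorphic (dihedral_quandle n, affine_map n a b)
           (dihedral_quandle n, affine_map n a' b')"
  shows "[a = a'] (mod int n)"
    and "e dvd int n \<Longrightarrow> e dvd a - 1 \<Longrightarrow> e dvd b \<longleftrightarrow> e dvd b'"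
proof -
  obtain \<psi> where iso: "\<psi> \<in> rack_iso (dihedral_quandle n) (dihedral_quandle n)"
    and eqv: "\<And>x. x \<in> {0..<int n} \<Longrightarrow> \<psi> (affine_map n a b x) = affine_map n a' b' (\<psi> x)"
    using assms(2) unfolding virtual_rack_isomorphic_def virtual_rack_iso_iff ex_in_conv[symmetric]
    by force
  obtain u c where u: "u \<in> units_mod n"
    and \<psi>: "\<And>x. x \<in> {0..<int n} \<Longrightarrow> \<psi> x = (u * x + c) mod int n"
    using rack_iso_dihedral_affine[OF assms(1) iso] by blast
  have cl: "z mod int n \<in> {0..<int n}" for z using assms(1) by auto
  have cong: "[u * (a * x + b) + c = a' * (u * x + c) + b'] (mod int n)"
    if "x \<in> {0..<int n}" for x
  proof -
    have "[u * ((a * x + b) mod int n) + c = a' * ((u * x + c) mod int n) + b'] (mod int n)"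
      using eqv[OF that] \<psi> cl that by (simp add: affine_map_def cong_def)
    moreover have "[u * (a * x + b) + c = u * ((a * x + b) mod int n) + c] (mod int n)"
      "[a' * ((u * x + c) mod int n) + b' = a' * (u * x + c) + b'] (mod int n)"
      by (intro cong_add cong_mult cong_refl; simp)+
    ultimately show ?thesis by (metis cong_def)
  qed
  have at0: "[u * b + c = a' * c + b'] (mod int n)"
    using cong[of 0] assms(1) by simp
  have "[u * (a * (1 mod int n) + b) + c = a' * (u * (1 mod int n) + c) + b'] (mod int n)"
    using cong cl by blast
  moreover have "[u * (a * 1 + b) + c = u * (a * (1 mod int n) + b) + c] (mod int n)"
    "[a' * (u * (1 mod int n) + c) + b' = a' * (u * 1 + c) + b'] (mod int n)"
    by (intro cong_add cong_mult cong_refl; simp)+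
  ultimately have "[u * (a * 1 + b) + c = a' * (u * 1 + c) + b'] (mod int n)"
    by (metis cong_def)
  from cong_diff[OF this at0] have "[u * a = u * a'] (mod int n)"
    by (simp add: algebra_simps)
  then show aa: "[a = a'] (mod int n)"
    using u by (simp add: units_mod_def cong_mult_lcancel)
  assume e: "e dvd int n" "e dvd a - 1"
  then have "[a' = 1] (mod e)"
    using aa cong_dvd_modulus cong_iff_dvd_diff cong_sym cong_trans by metis
  then have "[a' * c + b' = 1 * c + b'] (mod e)"
    by (intro cong_add cong_mult cong_refl)
  then have "[u * b + c = b' + c] (mod e)"
    using cong_trans[OF cong_dvd_modulus[OF at0 e(1)]] by (simp add: add.commute)
  then have "[u * b = b'] (mod e)" by (simp only: cong_add_rcancel)
  moreover have "coprime e u"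
    using u coprime_divisors[OF dvd_refl e(1), of u] by (simp add: units_mod_def coprime_commute)
  ultimately show "e dvd b \<longleftrightarrow> e dvd b'"
    by (metis cong_dvd_iff coprime_dvd_mult_right_iff)
qed

text \<open>
  Both \<open>d\<close> and \<open>d'\<close> are admissible divisors for the invariance of divisibility, so each divides the
  other.
\<close>

lemma affine_params_inj:
  assumes "n > 0" "(a, d) \<in> affine_params n" "(a', d') \<in> affine_params n"
    and iso: "virtual_rack_isomorphic (dihedral_quandle n, affine_map n a (int d))
           (dihedral_quandle n, affine_map n a' (int d'))"
  shows "(a, d) = (a', d')"
proof -
  note * = affine_virtual_isomorphic_dvd[OF assms(1) iso]
  have "a = a'"
    using *(1) assms(2,3) by (auto simp: affine_params_def units_mod_def cong_def)
  moreover have "int d dvd int d'" "int d' dvd int d"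
    using *(2)[of "int d"] *(2)[of "int d'"] assms(2,3) calculation
    by (auto simp: affine_params_def)
  ultimately show ?thesis by (auto intro: dvd_antisym)
qed

section \<open>Counting isomorphism classes\<close>

lemma virtual_quandle_over_dihedral_normal_form:
  assumes "n > 0" "V \<in> virtual_quandles_over (dihedral_quandle n)"
  obtains a d where "(a, d) \<in> affine_params n"
    "virtual_rack_isomorphic V (dihedral_quandle n, affine_map n a (int d))"
proof -
  let ?Q = "dihedral_quandle n"
  obtain R f where V: "V = (R, f)" by (cases V)
  then obtain \<psi> where R: "is_rack R" "f \<in> rack_auto R" "\<psi> \<in> rack_iso R ?Q"
    using assms(2) by (auto simp: virtual_quandles_over_def is_virtual_quandle_def
        is_virtual_rack_def rack_isomorphic_def)
  obtain g where g: "g \<in> rack_auto ?Q" "virtual_rack_isomorphic V (?Q, g)"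
    using transport_automorphism[OF R(1) is_rack_dihedral R(3,2)] V by blast
  obtain a b where a: "a \<in> units_mod n"
    and gx: "\<And>x. x \<in> {0..<int n} \<Longrightarrow> g x = (a * x + b) mod int n"
    using rack_iso_dihedral_affine[OF assms(1)] g(1) by (auto simp: rack_auto_def)
  have "g = affine_map n a b"
    using g(1) gx unfolding affine_map_def
    by (intro extensionalityI[of _ "{0..<int n}"]) (auto simp: rack_auto_def Bij_def)
  moreover define d where "d = nat (gcd b (gcd (a - 1) (int n)))"
  ultimately have "virtual_rack_isomorphic (?Q, g) (?Q, affine_map n a (int d))"
    using affine_virtual_isomorphic_normal_form[OF assms(1), of a b] a by (simp add: units_mod_def)
  then have "virtual_rack_isomorphic V (?Q, affine_map n a (int d))"
    using g(2) virtual_rack_isomorphic_trans by blast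
  moreover have "int d dvd int n" "int d dvd a - 1"
    by (auto simp: d_def intro: dvd_trans[OF gcd_dvd2])
  then have "(a, d) \<in> affine_params n"
    using a by (auto simp: affine_params_def)
  ultimately show ?thesis using that by blast
qed

text \<open>
  No class is missed when the underlying sets are drawn from an infinite type, since that type
  contains a set of every finite size.
\<close>

lemma virtual_quandle_over_dihedral_exists:
  assumes "infinite (UNIV :: 'a set)" "coprime a (int n)"
  obtains V :: "'a virtual_rack" where "V \<in> virtual_quandles_over (dihedral_quandle n)"
    "virtual_rack_isomorphic V (dihedral_quandle n, affine_map n a b)"
proof -
  let ?Q = "dihedral_quandle n"
  obtain Y :: "'a set" where "finite Y" "card Y = n"
    using infinite_arbitrarily_large[OF assms(1)] by blast
  then obtain \<psi> :: "int \<Rightarrow> 'a" where "bij_betw \<psi> (carrier ?Q) Y"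
    using finite_same_card_bij[of "{0..<int n}" Y] by auto
  then obtain S :: "'a rack" where S: "is_quandle S" "\<psi> \<in> rack_iso ?Q S"
    using transport_quandle[OF is_quandle_dihedral] by blast
  then have rS: "is_rack S" by (simp add: is_quandle_def)
  obtain g where g: "g \<in> rack_auto S"
      "virtual_rack_isomorphic (?Q, affine_map n a b) (S, g)"
    using transport_automorphism[OF is_rack_dihedral rS S(2) affine_map_auto[OF assms(2)]] .
  have "rack_isomorphic S ?Q"
    using rack_iso_inv[OF is_rack_dihedral S(2)] by (auto simp: rack_isomorphic_def)
  then have "(S, g) \<in> virtual_quandles_over ?Q"
    using S(1) rS g(1)
    by (simp add: virtual_quandles_over_def is_virtual_quandle_def is_virtual_rack_def)
  moreover have "virtual_rack_isomorphic (S, g) (?Q, affine_map n a b)"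
    using affine_map_auto[OF assms(2)] is_rack_dihedral
    by (intro virtual_rack_isomorphic_sym[OF _ g(2)]) (simp add: is_virtual_rack_def)
  ultimately show ?thesis using that by blast
qed

text \<open>
  The virtual quandles \<open>M p\<close> on residues may live over a type different from \<open>'a\<close>, so they are not
  representatives of the classes over \<open>'a\<close>. The bijection from parameters to classes is therefore
  \<open>C\<close>, which sends \<open>p\<close> to the set of all virtual quandles over \<open>'a\<close> isomorphic to \<open>M p\<close>.
\<close>

lemma card_virtual_quandle_classes_dihedral:
  assumes "n > 0" "infinite (UNIV :: 'a set)"
  shows "card (virtual_quandle_classes (dihedral_quandle n) :: 'a virtual_rack set set) =
    card (affine_params n)"
proof -
  let ?Q = "dihedral_quandle n"
  define A :: "'a virtual_rack set" where "A = virtual_quandles_over ?Q"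
  define M where "M = (\<lambda>(a, d). (?Q, affine_map n a (int d)))"
  define C where "C p = {V \<in> A. virtual_rack_isomorphic V (M p)}" for p
  have vr: "is_virtual_rack V" if "V \<in> A" for V
    using that by (simp add: A_def virtual_quandles_over_def is_virtual_quandle_def)
  have rep: "\<exists>p\<in>affine_params n. virtual_rack_isomorphic V (M p)" if "V \<in> A" for V
    using virtual_quandle_over_dihedral_normal_form[OF assms(1)] that
    unfolding A_def M_def by (metis (mono_tags, lifting) case_prod_conv)
  have ex: "\<exists>V\<in>A. virtual_rack_isomorphic V (M p)" if "p \<in> affine_params n" for p
  proof -
    obtain a d where p: "p = (a, d)" "coprime a (int n)"
      using \<open>p \<in> affine_params n\<close> by (auto simp: affine_params_def units_mod_def)
    obtain V :: "'a virtual_rack" where "V \<in> A" "virtual_rack_isomorphic V (M p)"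
      using virtual_quandle_over_dihedral_exists[OF assms(2) p(2), of "int d"]
      unfolding A_def M_def p(1) by auto
    then show ?thesis by blast
  qed
  have uniq: "p = q" if "p \<in> affine_params n" "q \<in> affine_params n" "V \<in> A"
    "virtual_rack_isomorphic V (M p)" "virtual_rack_isomorphic V (M q)" for p q V
  proof -
    have "virtual_rack_isomorphic (M p) (M q)"
      using that vr virtual_rack_isomorphic_sym virtual_rack_isomorphic_trans by metis
    then show ?thesis
      using that(1,2) affine_params_inj[OF assms(1)] by (cases p; cases q) (auto simp: M_def)
  qed
  have cls: "{W \<in> A. virtual_rack_isomorphic V W} = C p"
    if V: "V \<in> A" "virtual_rack_isomorphic V (M p)" for V p
  proof -
    have "virtual_rack_isomorphic V W \<longleftrightarrow> virtual_rack_isomorphic W (M p)" if "W \<in> A" for W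
    proof
      assume "virtual_rack_isomorphic V W"
      then show "virtual_rack_isomorphic W (M p)"
        using virtual_rack_isomorphic_sym[OF vr[OF V(1)]] V(2) virtual_rack_isomorphic_trans by blast
    next
      assume "virtual_rack_isomorphic W (M p)"
      then show "virtual_rack_isomorphic V W"
        using virtual_rack_isomorphic_sym[OF vr[OF that]] V(2) virtual_rack_isomorphic_trans by blast
    qed
    then show ?thesis unfolding C_def by blast
  qed
  have "virtual_quandle_classes ?Q = (\<lambda>V. {W \<in> A. virtual_rack_isomorphic V W}) ` A"
    by (auto simp: virtual_quandle_classes_def quotient_def A_def)
  also have "\<dots> = C ` affine_params n"
  proof (intro subset_antisym image_subsetI)
    fix V assume "V \<in> A"
    then show "{W \<in> A. virtual_rack_isomorphic V W} \<in> C ` affine_params n"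
      using rep cls by blast
  next
    fix p assume "p \<in> affine_params n"
    then obtain V where "V \<in> A" "virtual_rack_isomorphic V (M p)" using ex by blast
    then show "C p \<in> (\<lambda>V. {W \<in> A. virtual_rack_isomorphic V W}) ` A"
      using cls by (intro image_eqI[of _ _ V]) simp_all
  qed
  finally have "virtual_quandle_classes ?Q = C ` affine_params n" .
  moreover have "inj_on C (affine_params n)"
    using ex uniq unfolding inj_on_def C_def by blast
  ultimately show ?thesis by (simp add: card_image)
qed

theorem theorem1:
  fixes n :: nat
  assumes "n \<ge> 1"
    and "infinite (UNIV :: 'a set)"
  shows "real (card (virtual_quandle_classes (dihedral_quandle n) :: 'a virtual_rack set set)) =
    real (totient n) * (\<Sum>d | d dvd n. 1 / real (totient d))"
  using assms by (simp add: card_virtual_quandle_classes_dihedral card_affine_params)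

end
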